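(* Let $T=(Q,A,B,\longrightarrow,O,H)$ be a finite, non-blocking alternating transition system, $\phi$ an LTL$_{-X}(\mathbb{P})$ formula and $\Pi:Q\to2^{\mathbb{P}}$ a valuation function. If $\phi$ is total and there exist a state $q\in Q$ and a control strategy $f:Q^{+}\to A$ such that $\sigma\models\phi$ for all $\sigma\in Out(q,f)$, then the control strategy algorithm, run on input $(T,\phi,\Pi)$, finds (returns) a state $q'\in Q$ and a control strategy $f':Q^{+}\to A$ such that $\sigma\models\phi$ for all $\sigma\in Out(q',f')$.
   Context: $\mathbb{N}$ is the set of positive integers; $X^{+}$ and $X^{\omega}$ are the sets of non-empty finite strings and of infinite strings over $X$; $s[i]$ is the $i$-th letter of $s$, $s[1,i]$ its prefix of length $i$, $s[end]$ the last letter, $|s|$ the length. Alternating transition system: a tuple $T=(Q,A,B,\longrightarrow,O,H)$ with states $Q$, control labels $A$, disturbance labels $B$, transition relation $\longrightarrow\subseteq Q\times A\times B\times Q$ (written $q\xrightarrow{a,b}q'$), observation set $O$ and observation function $H:Q\to O$. Finite: $Q,A,B$ are finite. Non-blocking: $\{q':q\xrightarrow{a,b}q'\}\neq\emptyset$ for all $q\in Q,a\in A,b\in B$. LTL$_{-X}(\mathbb{P})$ over a finite set $\mathbb{P}$ of atomic propositions: $\varphi::=p\mid\neg\varphi\mid\varphi_1\wedge\varphi_2\mid\varphi_1\mathbf{U}\varphi_2$ with $p\in\mathbb{P}$. For $w\in(2^{\mathbb{P}})^{\omega}$ and $i\in\mathbb{N}$: $w[i]\models p$ iff $p\in w[i]$;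 $\neg,\wedge$ as usual; $w[i]\models\varphi_1\mathbf{U}\varphi_2$ iff there is $j\ge i$ with $w[j]\models\varphi_2$ and $w[k]\models\varphi_1$ for all $i\le k<j$. $w\models\varphi$ iff $w[1]\models\varphi$. For $\sigma\in Q^{\omega}$ and $\Pi:Q\to2^{\mathbb{P}}$, $\sigma\models\varphi$ means $\Pi(\sigma[1])\Pi(\sigma[2])\cdots\models\varphi$. Büchi automaton: $\mathcal{A}=(S,S_0,L,\to_{\mathcal{A}},F)$ with finite state set $S$, initial states $S_0\subseteq S$, input alphabet $L$, $\to_{\mathcal{A}}\subseteq S\times L\times S$, accepting states $F\subseteq S$. It accepts $w\in L^{\omega}$ iff there is $\rho\in S^{\omega}$ with $\rho[1]\in S_0$, $\rho[i]\xrightarrow{w[i]}_{\mathcal{A}}\rho[i+1]$ for all $i\in\mathbb{N}$, and some $x\in F$ appearing infinitely often in $\rho$. $\mathcal{A}$ is total if $S_0$ and $\{x':x\xrightarrow{l}_{\mathcal{A}}x'\}$ are singletons for all $x\in S$, $l\in L$. An LTL$_{-X}(\mathbb{P})$ formula $\phi$ is total if there is a total Büchi automaton with input alphabet $2^{\mathbb{P}}$ accepting exactly the words $w\in(2^{\mathbb{P}})^{\omega}$ with $w\models\phi$. A control strategy of $T$ is any function $f:Q^{+}\to A$. $Out(q,f)$ is the set of $\sigma\in Q^{\omega}$ with $\sigma[1]=q$ such that for all $i\in\mathbb{N}$ there is $b_i\in B$ with $\sigma[i]\xrightarrow{f(\sigma[1,i]),b_i}\sigma[i+1]$. Reactive agent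 $(q_0,succ_T)$ of $T$: for $q\in Q$, executing action $a\in A$ in world state $q$ has the set of possible successors $\{q'\in Q: q\xrightarrow{a,b}q'\text{ for some }b\in B\}$ (every action has duration 1). A reactive plan of $(q_0,succ_T)$ is a finite set $RP=\{(1,q_1,a_1,N_1),\dots,(k,q_k,a_k,N_k)\}$ where $1,\dots,k$ are plan states, plan state $i$ is labelled by world state $q_i\in Q$, $q_1=q_0$, $a_i\in A$ is the action executed in $i$, and $N_i\subseteq\{1,\dots,k\}$ is a set of successor plan states: the label $q_j$ of each $j\in N_i$ is a successor of $q_i$ under $a_i$, and for each successor $q'$ of $q_i$ under $a_i$ there is $j\in N_i$ with $q_j=q'$. A trajectory generated by $RP$ is $\sigma\in Q^{\omega}$ for which there is $i_1i_2\cdots\in\{1,\dots,k\}^{\omega}$ with $i_1=1$, $i_{j+1}\in N_{i_j}$ and $q_{i_j}=\sigma[j]$ for all $j\in\mathbb{N}$. $RP$ satisfies $\phi$ (w.r.t. $\Pi$) iff it generates at least one trajectory and all trajectories it generates satisfy $\phi$. Planner (Kabanza et al.'s planning algorithm, a known procedure): on input $(q_0,succ_T)$, $\phi$, $\Pi$ it returns either a reactive plan of $(q_0,succ_T)$ or failure; any returned plan satisfies $\phi$, and a plan is returned whenever one satisfying $\phi$ exists. A path of $RP$ is $s\in\{1,\dots,k\}^{+}$ with $|s|>1$ and $s[i+1]\in N_{s[i]}$ for all $i<|s|$. Simplification of $RP$: going through $i=1,2,\dots,k$, take the first $i$ for which there exist a path from $i$ to $i$ and a path from $1$ to $i$; let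 $suffix$ be a shortest path from $i$ to $i$ and $prefix$ a shortest path from $1$ to $i$ (if no such $i$ exists, only rule (c) below is used). Then for every plan state $i$ and every maximal family of $m>1$ elements $j_1,\dots,j_m\in N_i$ with $q_{j_1}=\dots=q_{j_m}$, keep exactly one of them in $N_i$ and remove the others: (a) if for some $l$ there is $n<|prefix|$ with $i=prefix[n]$, $j_l=prefix[n+1]$, keep $j_l$; (b) otherwise, if for some $l$ there is $n<|suffix|$ with $i=suffix[n]$, $j_l=suffix[n+1]$, keep $j_l$; (c) otherwise keep $j_1$. Strategy generated by a plan: if $RP$ is such that for every $i$ and every $q\in Q$ at most one $j\in N_i$ has $q_j=q$, then $f_{RP}:Q^{+}\to A$ is defined by: $f_{RP}(s)=a_{s_N[end]}$ if there is $s_N\in\{1,\dots,k\}^{+}$ with $|s_N|=|s|$, $s_N[1]=1$, $s_N[j+1]\in N_{s_N[j]}$ for $j<|s|$ and $s[j]=q_{s_N[j]}$ for all $j\le|s|$ (such $s_N$ is then unique); otherwise $f_{RP}(s)=a_1$. Control strategy algorithm, input $(T,\phi,\Pi)$: for each $q_0\in Q$ in turn, call the planner on $(q_0,succ_T),\phi,\Pi$; if a plan $RP_{kab}$ is found, let $RP$ be its simplification and return $q_0$ and $f_{RP}$. If no $q_0$ succeeds, return false.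
   Formalization: The disturbance label set B is additionally assumed non-empty; if B is empty, every Out(q,f) is empty, so every strategy wins vacuously, but no reactive plan generates a trajectory and the algorithm returns false. *)

theory Defs
  imports "HOL-Library.Omega_Words_Fun" "HOL-Library.FuncSet"
begin

text \<open>Infinite strings are the \<open>'a word\<close>s (functions on \<open>nat\<close>) of the library, so the letters
  written \<open>s[1], s[2], \<dots>\<close> on paper are \<open>s 0, s 1, \<dots>\<close>, and the finite prefix written \<open>s[1,i]\<close> is
  \<open>prefix i s\<close>. Finite strings are lists; \<open>X\<^sup>+\<close> consists of the non-empty lists over \<open>X\<close>.\<close>

section \<open>Alternating transition systems and control strategies\<close>

record ('q, 'a, 'b, 'o) ats =
  states :: "'q set"
  controls :: "'a set"
  disturbances :: "'b set"
  trans :: "('q \<times> 'a \<times> 'b \<times> 'q) set"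
  observations :: "'o set"
  obs :: "'q \<Rightarrow> 'o"

definition ats :: "('q, 'a, 'b, 'o) ats \<Rightarrow> bool" where
  "ats T \<longleftrightarrow>
     trans T \<subseteq> states T \<times> controls T \<times> disturbances T \<times> states T \<and>
     obs T \<in> states T \<rightarrow> observations T"

definition finite_ats :: "('q, 'a, 'b, 'o) ats \<Rightarrow> bool" where
  "finite_ats T \<longleftrightarrow> finite (states T) \<and> finite (controls T) \<and> finite (disturbances T)"

definition non_blocking :: "('q, 'a, 'b, 'o) ats \<Rightarrow> bool" where
  "non_blocking T \<longleftrightarrow>
     (\<forall>q\<in>states T. \<forall>a\<in>controls T. \<forall>b\<in>disturbances T. {q'. (q, a, b, q') \<in> trans T} \<noteq> {})"

definition control_strategy :: "('q, 'a, 'b, 'o) ats \<Rightarrow> ('q list \<Rightarrow> 'a) \<Rightarrow> bool" where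
  "control_strategy T f \<longleftrightarrow> (\<forall>s. s \<noteq> [] \<and> set s \<subseteq> states T \<longrightarrow> f s \<in> controls T)"

definition Out :: "('q, 'a, 'b, 'o) ats \<Rightarrow> 'q \<Rightarrow> ('q list \<Rightarrow> 'a) \<Rightarrow> 'q word set" where
  "Out T q f =
     {\<sigma>. range \<sigma> \<subseteq> states T \<and> \<sigma> 0 = q \<and>
         (\<forall>i. \<exists>b\<in>disturbances T. (\<sigma> i, f (prefix (Suc i) \<sigma>), b, \<sigma> (Suc i)) \<in> trans T)}"

section \<open>Linear temporal logic without next\<close>

datatype (atoms: 'p) ltl =
    Atom 'p
  | Neg "'p ltl"
  | Conj "'p ltl" "'p ltl"
  | Until "'p ltl" "'p ltl"

text \<open>\<open>sat_at w i \<phi>\<close> is the relation \<open>w[i + 1] \<Turnstile> \<phi>\<close>.\<close>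

primrec sat_at :: "'p set word \<Rightarrow> nat \<Rightarrow> 'p ltl \<Rightarrow> bool" where
  "sat_at w i (Atom p) \<longleftrightarrow> p \<in> w i"
| "sat_at w i (Neg \<phi>) \<longleftrightarrow> \<not> sat_at w i \<phi>"
| "sat_at w i (Conj \<phi>1 \<phi>2) \<longleftrightarrow> sat_at w i \<phi>1 \<and> sat_at w i \<phi>2"
| "sat_at w i (Until \<phi>1 \<phi>2) \<longleftrightarrow>
     (\<exists>j\<ge>i. sat_at w j \<phi>2 \<and> (\<forall>k. i \<le> k \<and> k < j \<longrightarrow> sat_at w k \<phi>1))"

definition sat :: "'p set word \<Rightarrow> 'p ltl \<Rightarrow> bool" where
  "sat w \<phi> \<longleftrightarrow> sat_at w 0 \<phi>"

definition ltl_over :: "'p set \<Rightarrow> 'p ltl \<Rightarrow> bool" where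
  "ltl_over P \<phi> \<longleftrightarrow> atoms \<phi> \<subseteq> P"

definition satisfies :: "('q \<Rightarrow> 'p set) \<Rightarrow> 'q word \<Rightarrow> 'p ltl \<Rightarrow> bool" where
  "satisfies \<nu> \<sigma> \<phi> \<longleftrightarrow> sat (\<nu> \<circ> \<sigma>) \<phi>"

section \<open>Buechi automata and total formulas\<close>

record ('s, 'l) buchi =
  bstates :: "'s set"
  binit :: "'s set"
  balphabet :: "'l set"
  btrans :: "('s \<times> 'l \<times> 's) set"
  baccept :: "'s set"

definition buchi :: "('s, 'l) buchi \<Rightarrow> bool" where
  "buchi \<A> \<longleftrightarrow>
     finite (bstates \<A>) \<and> binit \<A> \<subseteq> bstates \<A> \<and>
     btrans \<A> \<subseteq> bstates \<A> \<times> balphabet \<A> \<times> bstates \<A> \<and> baccept \<A> \<subseteq> bstates \<A>"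

definition baccepts :: "('s, 'l) buchi \<Rightarrow> 'l word \<Rightarrow> bool" where
  "baccepts \<A> w \<longleftrightarrow>
     (\<exists>\<rho>. range \<rho> \<subseteq> bstates \<A> \<and> \<rho> 0 \<in> binit \<A> \<and>
          (\<forall>i. (\<rho> i, w i, \<rho> (Suc i)) \<in> btrans \<A>) \<and>
          (\<exists>x\<in>baccept \<A>. x \<in> limit \<rho>))"

definition total_buchi :: "('s, 'l) buchi \<Rightarrow> bool" where
  "total_buchi \<A> \<longleftrightarrow>
     is_singleton (binit \<A>) \<and>
     (\<forall>x\<in>bstates \<A>. \<forall>l\<in>balphabet \<A>. is_singleton {x'. (x, l, x') \<in> btrans \<A>})"

definition recognizes :: "('s, 'p set) buchi \<Rightarrow> 'p set \<Rightarrow> 'p ltl \<Rightarrow> bool" where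
  "recognizes \<A> P \<phi> \<longleftrightarrow>
     balphabet \<A> = Pow P \<and> (\<forall>w. range w \<subseteq> Pow P \<longrightarrow> (baccepts \<A> w \<longleftrightarrow> sat w \<phi>))"

text \<open>A definition cannot quantify over the type of automaton states. As the state set is finite,
  it can be taken to consist of natural numbers; \<open>total_formulaI\<close> below shows that this loses
  nothing.\<close>

definition total_formula :: "'p set \<Rightarrow> 'p ltl \<Rightarrow> bool" where
  "total_formula P \<phi> \<longleftrightarrow>
     (\<exists>\<A> :: (nat, 'p set) buchi. buchi \<A> \<and> total_buchi \<A> \<and> recognizes \<A> P \<phi>)"

lemma total_formulaI:
  fixes \<A> :: "('s, 'p set) buchi"
  assumes b: "buchi \<A>" and t: "total_buchi \<A>" and r: "recognizes \<A> P \<phi>"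
  shows "total_formula P \<phi>"
proof -
  have fin: "finite (bstates \<A>)" using b by (simp add: buchi_def)
  then obtain h :: "'s \<Rightarrow> nat" where h: "inj_on h (bstates \<A>)"
    using finite_imp_inj_to_nat_seg by metis
  define \<B> :: "(nat, 'p set) buchi" where
    "\<B> = \<lparr>bstates = h ` bstates \<A>, binit = h ` binit \<A>, balphabet = balphabet \<A>,
          btrans = (\<lambda>(x, l, y). (h x, l, h y)) ` btrans \<A>, baccept = h ` baccept \<A>\<rparr>"
  have tr: "btrans \<A> \<subseteq> bstates \<A> \<times> balphabet \<A> \<times> bstates \<A>"
    and ini: "binit \<A> \<subseteq> bstates \<A>" and acc: "baccept \<A> \<subseteq> bstates \<A>"
    using b by (auto simp: buchi_def)
  have bB: "buchi \<B>"
    using fin tr ini acc by (fastforce simp: buchi_def \<B>_def)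
  have step: "(h x, l, y') \<in> btrans \<B> \<longleftrightarrow> (\<exists>y. y' = h y \<and> (x, l, y) \<in> btrans \<A>)"
    if "x \<in> bstates \<A>" for x l y'
  proof
    assume "(h x, l, y') \<in> btrans \<B>"
    then obtain u y where u: "(u, l, y) \<in> btrans \<A>" "h x = h u" "y' = h y"
      by (auto simp: \<B>_def)
    then have "u = x" using inj_onD[OF h] that tr by blast
    with u show "\<exists>y. y' = h y \<and> (x, l, y) \<in> btrans \<A>" by blast
  qed (force simp: \<B>_def)
  have tB: "total_buchi \<B>"
    unfolding total_buchi_def
  proof (intro conjI ballI)
    show "is_singleton (binit \<B>)"
      using t by (auto simp: total_buchi_def \<B>_def is_singleton_def)
    fix x' l assume "x' \<in> bstates \<B>" and l: "l \<in> balphabet \<B>"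
    then obtain x where x: "x \<in> bstates \<A>" "x' = h x" by (auto simp: \<B>_def)
    have "is_singleton {y. (x, l, y) \<in> btrans \<A>}"
      using t x l by (simp add: total_buchi_def \<B>_def)
    moreover have "{y'. (x', l, y') \<in> btrans \<B>} = h ` {y. (x, l, y) \<in> btrans \<A>}"
      using step[OF x(1)] x(2) by auto
    ultimately show "is_singleton {y'. (x', l, y') \<in> btrans \<B>}"
      by (auto simp: is_singleton_def)
  qed
  have "baccepts \<B> w \<longleftrightarrow> baccepts \<A> w" for w
  proof
    assume "baccepts \<A> w"
    then obtain \<rho> x where *: "range \<rho> \<subseteq> bstates \<A>" "\<rho> 0 \<in> binit \<A>"
      "\<forall>i. (\<rho> i, w i, \<rho> (Suc i)) \<in> btrans \<A>" "x \<in> baccept \<A>" "x \<in> limit \<rho>"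
      by (auto simp: baccepts_def)
    have "h x \<in> limit (h \<circ> \<rho>)"
      using *(5) INFM_mono[of "\<lambda>n. \<rho> n = x" "\<lambda>n. (h \<circ> \<rho>) n = h x"] by (simp add: limit_def)
    moreover have "\<forall>i. ((h \<circ> \<rho>) i, w i, (h \<circ> \<rho>) (Suc i)) \<in> btrans \<B>"
    proof
      fix i
      have "\<rho> i \<in> bstates \<A>" using *(1) by blast
      then show "((h \<circ> \<rho>) i, w i, (h \<circ> \<rho>) (Suc i)) \<in> btrans \<B>"
        using *(3) step by auto
    qed
    moreover have "range (h \<circ> \<rho>) \<subseteq> bstates \<B>" "(h \<circ> \<rho>) 0 \<in> binit \<B>" "h x \<in> baccept \<B>"
      using *(1,2,4) by (auto simp: \<B>_def)
    ultimately show "baccepts \<B> w"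
      unfolding baccepts_def by blast
  next
    assume "baccepts \<B> w"
    then obtain \<rho>' x' where *: "range \<rho>' \<subseteq> bstates \<B>" "\<rho>' 0 \<in> binit \<B>"
      "\<forall>i. (\<rho>' i, w i, \<rho>' (Suc i)) \<in> btrans \<B>" "x' \<in> baccept \<B>" "x' \<in> limit \<rho>'"
      by (auto simp: baccepts_def)
    have "\<forall>i. \<exists>x\<in>bstates \<A>. \<rho>' i = h x"
      using *(1) by (auto simp: \<B>_def)
    then obtain \<rho> where \<rho>: "\<And>i. \<rho> i \<in> bstates \<A>" "\<And>i. \<rho>' i = h (\<rho> i)"
      by metis
    from *(4) obtain x where x: "x \<in> baccept \<A>" "x' = h x" by (auto simp: \<B>_def)
    have xs: "x \<in> bstates \<A>" using x acc by auto
    have "\<rho> 0 \<in> binit \<A>"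
    proof -
      obtain y where "y \<in> binit \<A>" "h (\<rho> 0) = h y"
        using *(2) \<rho>(2) by (auto simp: \<B>_def)
      then show ?thesis using ini inj_onD[OF h _ \<rho>(1)] by auto
    qed
    moreover have "(\<rho> i, w i, \<rho> (Suc i)) \<in> btrans \<A>" for i
    proof -
      obtain y where y: "h (\<rho> (Suc i)) = h y" "(\<rho> i, w i, y) \<in> btrans \<A>"
        using *(3) \<rho> step by metis
      moreover have "y \<in> bstates \<A>" using y tr by auto
      ultimately show ?thesis using inj_onD[OF h] \<rho>(1) by metis
    qed
    moreover have "x \<in> limit \<rho>"
      using *(5) x(2) \<rho>(2) inj_on_eq_iff[OF h \<rho>(1) xs] by (simp add: limit_def)
    ultimately show "baccepts \<A> w"
      unfolding baccepts_def using \<rho>(1) x(1) by blast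
  qed
  then have "recognizes \<B> P \<phi>"
    using r by (simp add: recognizes_def \<B>_def)
  with bB tB show ?thesis unfolding total_formula_def by blast
qed

section \<open>Reactive agents, reactive plans and the planner\<close>

record ('q, 'a) agent =
  world_states :: "'q set"
  actions :: "'a set"
  init :: "'q"
  succs :: "'q \<Rightarrow> 'a \<Rightarrow> 'q set"

definition agent_of :: "('q, 'a, 'b, 'o) ats \<Rightarrow> 'q \<Rightarrow> ('q, 'a) agent" where
  "agent_of T q0 =
     \<lparr>world_states = states T, actions = controls T, init = q0,
      succs = (\<lambda>q a. {q' \<in> states T. \<exists>b\<in>disturbances T. (q, a, b, q') \<in> trans T})\<rparr>"

text \<open>The plan \<open>{(1, q\<^sub>1, a\<^sub>1, N\<^sub>1), \<dots>, (k, q\<^sub>k, a\<^sub>k, N\<^sub>k)}\<close> is stored as the number \<open>k\<close> together with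
  the maps \<open>i \<mapsto> q\<^sub>i\<close>, \<open>i \<mapsto> a\<^sub>i\<close>, \<open>i \<mapsto> N\<^sub>i\<close>, whose values outside \<open>{1..k}\<close> are irrelevant.\<close>

record ('q, 'a) plan =
  nplan :: nat
  lab :: "nat \<Rightarrow> 'q"
  act :: "nat \<Rightarrow> 'a"
  nexts :: "nat \<Rightarrow> nat set"

definition plan_states :: "('q, 'a) plan \<Rightarrow> nat set" where
  "plan_states RP = {1..nplan RP}"

definition reactive_plan :: "('q, 'a) agent \<Rightarrow> ('q, 'a) plan \<Rightarrow> bool" where
  "reactive_plan ag RP \<longleftrightarrow>
     1 \<in> plan_states RP \<and> lab RP 1 = init ag \<and>
     (\<forall>i\<in>plan_states RP.
        lab RP i \<in> world_states ag \<and> act RP i \<in> actions ag \<and> nexts RP i \<subseteq> plan_states RP \<and>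
        (\<forall>j\<in>nexts RP i. lab RP j \<in> succs ag (lab RP i) (act RP i)) \<and>
        (\<forall>q'\<in>succs ag (lab RP i) (act RP i). \<exists>j\<in>nexts RP i. lab RP j = q'))"

definition trajectories :: "('q, 'a) plan \<Rightarrow> 'q word set" where
  "trajectories RP =
     {\<sigma>. \<exists>r :: nat word. range r \<subseteq> plan_states RP \<and> r 0 = 1 \<and>
           (\<forall>j. r (Suc j) \<in> nexts RP (r j)) \<and> (\<forall>j. lab RP (r j) = \<sigma> j)}"

definition plan_satisfies :: "('q \<Rightarrow> 'p set) \<Rightarrow> ('q, 'a) plan \<Rightarrow> 'p ltl \<Rightarrow> bool" where
  "plan_satisfies \<nu> RP \<phi> \<longleftrightarrow>
     trajectories RP \<noteq> {} \<and> (\<forall>\<sigma>\<in>trajectories RP. satisfies \<nu> \<sigma> \<phi>)"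

text \<open>A planner is a function returning a plan or failure (\<open>None\<close>). This is its input-output
  specification on one input.\<close>

type_synonym ('q, 'a, 'p) planner =
  "('q, 'a) agent \<Rightarrow> 'p ltl \<Rightarrow> ('q \<Rightarrow> 'p set) \<Rightarrow> ('q, 'a) plan option"

definition planner_correct ::
  "('q, 'a, 'p) planner \<Rightarrow> ('q, 'a) agent \<Rightarrow> 'p ltl \<Rightarrow> ('q \<Rightarrow> 'p set) \<Rightarrow> bool" where
  "planner_correct planner ag \<phi> \<nu> \<longleftrightarrow>
     (\<forall>RP. planner ag \<phi> \<nu> = Some RP \<longrightarrow> reactive_plan ag RP \<and> plan_satisfies \<nu> RP \<phi>) \<and>
     ((\<exists>RP. reactive_plan ag RP \<and> plan_satisfies \<nu> RP \<phi>) \<longrightarrow> (\<exists>RP. planner ag \<phi> \<nu> = Some RP))"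

lemma ex_planner:
  "\<exists>planner :: ('q, 'a, 'p) planner. \<forall>ag \<phi> \<nu>. planner_correct planner ag \<phi> \<nu>"
proof -
  let ?good = "\<lambda>ag \<phi> \<nu> RP. reactive_plan ag RP \<and> plan_satisfies \<nu> RP \<phi>"
  let ?pl = "\<lambda>ag \<phi> \<nu>. if \<exists>RP. ?good ag \<phi> \<nu> RP then Some (SOME RP. ?good ag \<phi> \<nu> RP) else None"
  have "planner_correct ?pl ag \<phi> \<nu>" for ag \<phi> \<nu>
    using someI_ex[of "?good ag \<phi> \<nu>"] unfolding planner_correct_def by auto
  then show ?thesis by (intro exI[of _ ?pl]) blast
qed

section \<open>Simplification of plans\<close>

definition path :: "('q, 'a) plan \<Rightarrow> nat list \<Rightarrow> bool" where
  "path RP s \<longleftrightarrow>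
     length s > 1 \<and> set s \<subseteq> plan_states RP \<and>
     (\<forall>n. Suc n < length s \<longrightarrow> s ! Suc n \<in> nexts RP (s ! n))"

definition path_betw :: "('q, 'a) plan \<Rightarrow> nat \<Rightarrow> nat \<Rightarrow> nat list \<Rightarrow> bool" where
  "path_betw RP i j s \<longleftrightarrow> path RP s \<and> hd s = i \<and> last s = j"

definition shortest_path :: "('q, 'a) plan \<Rightarrow> nat \<Rightarrow> nat \<Rightarrow> nat list \<Rightarrow> bool" where
  "shortest_path RP i j s \<longleftrightarrow>
     path_betw RP i j s \<and> (\<forall>s'. path_betw RP i j s' \<longrightarrow> length s \<le> length s')"

definition lasso_state :: "('q, 'a) plan \<Rightarrow> nat \<Rightarrow> bool" where
  "lasso_state RP i \<longleftrightarrow>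
     i \<in> plan_states RP \<and> (\<exists>s. path_betw RP i i s) \<and> (\<exists>s. path_betw RP 1 i s)"

text \<open>\<open>lasso RP pre suf\<close>: the lists \<open>pre\<close> and \<open>suf\<close> are an admissible choice of the prefix and the
  suffix computed by the simplification. If there is no lasso state, both are empty, so that only
  the default branch of \<open>kept\<close> below applies.\<close>

definition lasso :: "('q, 'a) plan \<Rightarrow> nat list \<Rightarrow> nat list \<Rightarrow> bool" where
  "lasso RP pre suf \<longleftrightarrow>
     (if \<exists>i. lasso_state RP i
      then let i = (LEAST i. lasso_state RP i)
           in shortest_path RP 1 i pre \<and> shortest_path RP i i suf
      else pre = [] \<and> suf = [])"

definition edges :: "nat list \<Rightarrow> (nat \<times> nat) set" where
  "edges s = {(s ! n, s ! Suc n) | n. Suc n < length s}"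

text \<open>\<open>kept pre suf i J j\<close>: \<open>j\<close> may be the element kept from the family \<open>J\<close> of equally labelled
  successors of \<open>i\<close>. In the default branch the family comes in an unspecified order, so its first element
  may be any of its elements.\<close>

definition kept :: "nat list \<Rightarrow> nat list \<Rightarrow> nat \<Rightarrow> nat set \<Rightarrow> nat \<Rightarrow> bool" where
  "kept pre suf i J j \<longleftrightarrow>
     j \<in> J \<and>
     (if \<exists>l\<in>J. (i, l) \<in> edges pre then (i, j) \<in> edges pre
      else if \<exists>l\<in>J. (i, l) \<in> edges suf then (i, j) \<in> edges suf
      else True)"

definition same_lab :: "('q, 'a) plan \<Rightarrow> nat \<Rightarrow> 'q \<Rightarrow> nat set" where
  "same_lab RP i q = {j \<in> nexts RP i. lab RP j = q}"

text \<open>The simplification is determined only up to the choice of shortest paths and the order of the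
  families, so it is a relation between plans.\<close>

definition simplification_of :: "('q, 'a) plan \<Rightarrow> ('q, 'a) plan \<Rightarrow> bool" where
  "simplification_of RP RP' \<longleftrightarrow>
     nplan RP' = nplan RP \<and> lab RP' = lab RP \<and> act RP' = act RP \<and>
     (\<exists>pre suf. lasso RP pre suf \<and>
        (\<forall>i\<in>plan_states RP. nexts RP' i \<subseteq> nexts RP i \<and>
           (\<forall>q. if card (same_lab RP i q) > 1
                then \<exists>j. kept pre suf i (same_lab RP i q) j \<and> same_lab RP' i q = {j}
                else same_lab RP' i q = same_lab RP i q)))"

definition simplifier :: "(('q, 'a) plan \<Rightarrow> ('q, 'a) plan) \<Rightarrow> bool" where
  "simplifier simplify \<longleftrightarrow>
     (\<forall>ag RP. reactive_plan ag RP \<longrightarrow> simplification_of RP (simplify RP))"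

lemma ex_simplifier: "\<exists>simplify :: ('q, 'a) plan \<Rightarrow> ('q, 'a) plan. simplifier simplify"
proof -
  have "\<exists>RP'. simplification_of RP RP'" for RP :: "('q, 'a) plan"
  proof -
    have sp: "\<exists>s. shortest_path RP i j s" if "\<exists>s. path_betw RP i j s" for i j
    proof -
      from that obtain s where "path_betw RP i j s" ..
      then have "\<exists>s. path_betw RP i j s \<and> (\<forall>s'. path_betw RP i j s' \<longrightarrow> length s \<le> length s')"
        by (rule ex_has_least_nat[where m = length])
      then show ?thesis by (simp add: shortest_path_def)
    qed
    have "\<exists>pre suf. lasso RP pre suf"
    proof (cases "\<exists>i. lasso_state RP i")
      case True
      then have "lasso_state RP (LEAST i. lasso_state RP i)" by (rule LeastI_ex)
      with True sp show ?thesis unfolding lasso_def lasso_state_def Let_def by simp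
    qed (auto simp: lasso_def)
    then obtain pre suf where l: "lasso RP pre suf" by blast
    have "\<exists>j. kept pre suf i J j" if "J \<noteq> {}" for i J
    proof -
      from that obtain j where "j \<in> J" by blast
      then show ?thesis
        by (cases "\<exists>l\<in>J. (i, l) \<in> edges pre"; cases "\<exists>l\<in>J. (i, l) \<in> edges suf")
          (auto simp: kept_def)
    qed
    note k = this
    define c where "c i J = (SOME j. kept pre suf i J j)" for i J
    have c: "kept pre suf i J (c i J)" if "J \<noteq> {}" for i J
      unfolding c_def using someI_ex[OF k[OF that]] .
    define N' where "N' i = {j \<in> nexts RP i. card (same_lab RP i (lab RP j)) > 1 \<longrightarrow>
        j = c i (same_lab RP i (lab RP j))}" for i
    define RP' where "RP' = RP\<lparr>nexts := N'\<rparr>"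
    have fam: "if card (same_lab RP i q) > 1
        then \<exists>j. kept pre suf i (same_lab RP i q) j \<and> same_lab RP' i q = {j}
        else same_lab RP' i q = same_lab RP i q" for i q
    proof (cases "card (same_lab RP i q) > 1")
      case True
      then have "same_lab RP i q \<noteq> {}" by auto
      from c[OF this] have k: "kept pre suf i (same_lab RP i q) (c i (same_lab RP i q))" .
      then have "c i (same_lab RP i q) \<in> same_lab RP i q" by (simp add: kept_def)
      then have "same_lab RP' i q = {c i (same_lab RP i q)}"
        using True by (auto simp: same_lab_def RP'_def N'_def)
      with k True show ?thesis by auto
    next
      case False
      then show ?thesis by (auto simp: same_lab_def RP'_def N'_def)
    qed
    have "nexts RP' i \<subseteq> nexts RP i" for i
      by (auto simp: RP'_def N'_def)
    moreover have "nplan RP' = nplan RP" "lab RP' = lab RP" "act RP' = act RP"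
      by (simp_all add: RP'_def)
    ultimately have "simplification_of RP RP'"
      unfolding simplification_of_def using l fam by blast
    then show ?thesis ..
  qed
  then show ?thesis unfolding simplifier_def by metis
qed

section \<open>The control strategy algorithm\<close>

definition follows :: "('q, 'a) plan \<Rightarrow> 'q list \<Rightarrow> nat list \<Rightarrow> bool" where
  "follows RP s sN \<longleftrightarrow>
     sN \<noteq> [] \<and> set sN \<subseteq> plan_states RP \<and> length sN = length s \<and> sN ! 0 = 1 \<and>
     (\<forall>j. Suc j < length s \<longrightarrow> sN ! Suc j \<in> nexts RP (sN ! j)) \<and>
     (\<forall>j<length s. s ! j = lab RP (sN ! j))"

text \<open>Meant for plans in which the elements of each successor set have pairwise different labels;
  then at most one \<open>sN\<close> follows \<open>s\<close>.\<close>

definition plan_strategy :: "('q, 'a) plan \<Rightarrow> 'q list \<Rightarrow> 'a" where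
  "plan_strategy RP s =
     (if \<exists>sN. follows RP s sN then act RP (last (THE sN. follows RP s sN)) else act RP 1)"

text \<open>The algorithm is parametrised by a planner, by a function resolving the choices left open in
  the simplification, and by the order (a list) in which the states are tried.\<close>

primrec control_strategy_algorithm ::
  "('q, 'a, 'p) planner \<Rightarrow> (('q, 'a) plan \<Rightarrow> ('q, 'a) plan) \<Rightarrow> 'q list \<Rightarrow>
   ('q, 'a, 'b, 'o) ats \<Rightarrow> 'p ltl \<Rightarrow> ('q \<Rightarrow> 'p set) \<Rightarrow> ('q \<times> ('q list \<Rightarrow> 'a)) option" where
  "control_strategy_algorithm planner simplify [] T \<phi> \<nu> = None"
| "control_strategy_algorithm planner simplify (q0 # qs) T \<phi> \<nu> =
     (case planner (agent_of T q0) \<phi> \<nu> of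
        Some RP\<^sub>k\<^sub>a\<^sub>b \<Rightarrow> Some (q0, plan_strategy (simplify RP\<^sub>k\<^sub>a\<^sub>b))
      | None \<Rightarrow> control_strategy_algorithm planner simplify qs T \<phi> \<nu>)"

end

theory Submission
  imports Defs
begin

text \<open>A total automaton is a deterministic Buechi automaton, so its product with \<open>T\<close> is a finite
  Buechi game. Every node of the winning region reaches an accepting node again, within the
  region, in a bounded number of steps, for otherwise a winning strategy would admit a play that
  is never accepting. Moving so that this number decreases is winning and memoryless; hence it can
  be written down as a reactive plan, one plan state per winning node. So the planner succeeds for
  some state. Simplifying a plan only removes trajectories, and since it leaves one successor for
  each label, the outcomes of the generated strategy are trajectories of the simplified plan.\<close>

section \<open>Memoryless strategies in Buechi games\<close>

text \<open>A turn is a single step: the player names an action and the opponent answers with an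
  element of the successor set. Plays are infinite, so a move without successors leaves the opponent
  no play.\<close>

definition plays :: "('v \<Rightarrow> 'a \<Rightarrow> 'v set) \<Rightarrow> 'v \<Rightarrow> ('v list \<Rightarrow> 'a) \<Rightarrow> 'v word set" where
  "plays succ v g = {\<pi>. \<pi> 0 = v \<and> (\<forall>i. \<pi> (Suc i) \<in> succ (\<pi> i) (g (prefix (Suc i) \<pi>)))}"

definition buchi_winning ::
  "'v set \<Rightarrow> 'a set \<Rightarrow> ('v \<Rightarrow> 'a \<Rightarrow> 'v set) \<Rightarrow> 'v set \<Rightarrow> 'v \<Rightarrow> ('v list \<Rightarrow> 'a) \<Rightarrow> bool" where
  "buchi_winning V A succ F v g \<longleftrightarrow>
     (\<forall>h. h \<noteq> [] \<and> set h \<subseteq> V \<longrightarrow> g h \<in> A) \<and> (\<forall>\<pi>\<in>plays succ v g. \<exists>\<^sub>\<infinity>i. \<pi> i \<in> F)"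

lemma prefix_Suc_build: "prefix (Suc n) (v ## \<pi>) = v # prefix n \<pi>"
  by (induction n) simp_all

text \<open>With \<open>v\<close> prepended, a play from \<open>u\<close> under the shifted strategy
  is a play from \<open>v\<close> under \<open>g\<close>, and visiting \<open>F\<close> infinitely
  often does not depend on the first letter.\<close>

lemma buchi_winning_residual:
  assumes win: "buchi_winning V A succ F v g" and v: "v \<in> V" and u: "u \<in> succ v (g [v])"
  shows "buchi_winning V A succ F u (\<lambda>h. g (v # h))"
  unfolding buchi_winning_def
proof (intro conjI ballI)
  show "\<forall>h. h \<noteq> [] \<and> set h \<subseteq> V \<longrightarrow> g (v # h) \<in> A"
    using win v by (simp add: buchi_winning_def)
  fix \<pi> assume \<pi>: "\<pi> \<in> plays succ u (\<lambda>h. g (v # h))"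
  have "(v ## \<pi>) (Suc i) \<in> succ ((v ## \<pi>) i) (g (prefix (Suc i) (v ## \<pi>)))" for i
    using \<pi> u by (cases i) (simp_all only: prefix_Suc_build, auto simp: plays_def)
  then have "v ## \<pi> \<in> plays succ v g" by (simp add: plays_def)
  then have "\<exists>\<^sub>\<infinity>i. (v ## \<pi>) i \<in> F" using win by (simp add: buchi_winning_def)
  then have "\<exists>\<^sub>\<infinity>i. (v ## \<pi>) (Suc i) \<in> F"
    using eventually_sequentially_Suc[of "\<lambda>i. (v ## \<pi>) i \<notin> F"]
    unfolding frequently_def cofinite_eq_sequentially by blast
  then show "\<exists>\<^sub>\<infinity>i. \<pi> i \<in> F" by simp
qed

text \<open>From stage \<open>n\<close> the player can force, inside \<open>W\<close>, a visit to
  \<open>F\<close> (or a move without successors) after at least one and at most \<open>n\<close>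
  moves. Nodes of \<open>F\<close> are not included for free, so the way back to \<open>F\<close> is
  measured for them too.\<close>

primrec attractor ::
  "'v set \<Rightarrow> 'a set \<Rightarrow> ('v \<Rightarrow> 'a \<Rightarrow> 'v set) \<Rightarrow> 'v set \<Rightarrow> nat \<Rightarrow> 'v set" where
  "attractor W A succ F 0 = {}"
| "attractor W A succ F (Suc n) =
     {v \<in> W. \<exists>a\<in>A. succ v a \<subseteq> W \<and> succ v a \<subseteq> F \<union> attractor W A succ F n}"

lemma attractor_mono: "m \<le> n \<Longrightarrow> attractor W A succ F m \<subseteq> attractor W A succ F n"
proof (rule lift_Suc_mono_le[of "attractor W A succ F"])
  show "attractor W A succ F k \<subseteq> attractor W A succ F (Suc k)" for k
  proof (induction k)
    case (Suc k)
    then have "F \<union> attractor W A succ F k \<subseteq> F \<union> attractor W A succ F (Suc k)" by blast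
    then show ?case unfolding attractor.simps(2)[of _ _ _ _ k] attractor.simps(2)[of _ _ _ _ "Suc k"]
      by (blast dest: subset_trans)
  qed simp
qed

text \<open>\<open>W\<close> is finite, so finitely many successors enter the attractor by a common
  stage; the union over the natural numbers is already a fixed point.\<close>

lemma attractor_closed:
  assumes fin: "finite W" and v: "v \<in> W" "a \<in> A" "succ v a \<subseteq> W"
    and s: "succ v a \<subseteq> F \<union> (\<Union>n. attractor W A succ F n)"
  shows "v \<in> (\<Union>n. attractor W A succ F n)"
proof -
  let ?R = "attractor W A succ F"
  have "\<forall>u\<in>succ v a - F. \<exists>n. u \<in> ?R n" using s by auto
  then obtain N where N: "u \<in> ?R (N u)" if "u \<in> succ v a - F" for u by metis
  have fs: "finite (N ` (succ v a - F))" using fin v(3) by (meson finite_Diff finite_imageI finite_subset)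
  \<comment> \<open>If all successors lie in \<open>F\<close>, this is \<open>Max\<close> of the
    empty set; any value then serves.\<close>
  have "succ v a \<subseteq> F \<union> ?R (Max (N ` (succ v a - F)))"
  proof
    fix u assume "u \<in> succ v a"
    moreover have "N u \<le> Max (N ` (succ v a - F))" if "u \<in> succ v a - F"
      using that fs by simp
    ultimately show "u \<in> F \<union> ?R (Max (N ` (succ v a - F)))"
      using N attractor_mono[of "N u" "Max (N ` (succ v a - F))" W A succ F] by blast
  qed
  then have "v \<in> ?R (Suc (Max (N ` (succ v a - F))))" using v by auto
  then show ?thesis by blast
qed

text \<open>At a node outside the attractor, the action of a winning strategy has a successor
  outside both \<open>F\<close> and the attractor. The residual strategy still wins there, so
  repetition yields a play of the original strategy that avoids \<open>F\<close> after its
  start.\<close>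

lemma winning_region_subset_attractor:
  assumes fin: "finite V" and cl: "\<And>v a. v \<in> V \<Longrightarrow> a \<in> A \<Longrightarrow> succ v a \<subseteq> V"
    and W: "W = {v \<in> V. \<exists>g. buchi_winning V A succ F v g}"
  shows "W \<subseteq> (\<Union>n. attractor W A succ F n)"
proof (rule subsetI, rule ccontr)
  let ?R = "\<Union>n. attractor W A succ F n"
  let ?win = "buchi_winning V A succ F"
  fix v0 assume "v0 \<in> W" and v0: "v0 \<notin> ?R"
  then obtain g0 where g0: "?win v0 g0" and v0V: "v0 \<in> V" using W by blast
  \<comment> \<open>Each \<open>x n\<close> pairs the current node with the residual of
    \<open>g0\<close> after the moves made so far.\<close>
  have "\<exists>x. fst (x 0) = v0 \<and> snd (x 0) = g0 \<and>
      (\<forall>n. (fst (x n) \<in> V \<and> fst (x n) \<notin> ?R \<and> ?win (fst (x n)) (snd (x n))) \<and>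
       (fst (x (Suc n)) \<in> succ (fst (x n)) (snd (x n) [fst (x n)]) - F \<and>
        snd (x (Suc n)) = (\<lambda>h. snd (x n) (fst (x n) # h))))"
    (is "\<exists>x. _ \<and> _ \<and> (\<forall>n. ?P (x n) \<and> ?Q (x n) (x (Suc n)))")
  proof -
    have step: "\<exists>y. ?P y \<and> ?Q x y" if "?P x" for x
    proof -
      obtain v g where x: "x = (v, g)" by (cases x)
      have v: "v \<in> V" "v \<notin> ?R" "?win v g" using that x by auto
      then have a: "g [v] \<in> A" by (simp add: buchi_winning_def)
      have sW: "succ v (g [v]) \<subseteq> W"
        using buchi_winning_residual[OF v(3,1)] cl[OF v(1) a] W by blast
      have "\<not> succ v (g [v]) \<subseteq> F \<union> ?R"
        using attractor_closed[of W v "g [v]" A succ F] fin W v a sW by auto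
      then obtain u where u: "u \<in> succ v (g [v])" "u \<notin> F" "u \<notin> ?R" by blast
      have "?P (u, \<lambda>h. g (v # h)) \<and> ?Q x (u, \<lambda>h. g (v # h))"
        using u sW W x buchi_winning_residual[OF v(3,1) u(1)] by auto
      then show ?thesis by blast
    qed
    have "\<exists>x. x 0 = (v0, g0) \<and> (\<forall>n. ?P (x n) \<and> ?Q (x n) (x (Suc n)))"
    proof -
      \<comment> \<open>\<open>dependent_nat_choice\<close> leaves the first element open, so a
        clause on index 0 of the invariant forces the start.\<close>
      have "\<exists>x. \<forall>n. (?P (x n) \<and> (n = 0 \<longrightarrow> x n = (v0, g0))) \<and> ?Q (x n) (x (Suc n))"
      proof (rule dependent_nat_choice)
        show "\<exists>x. ?P x \<and> ((0::nat) = 0 \<longrightarrow> x = (v0, g0))"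
          using g0 v0 v0V by auto
      next
        fix x :: "'a \<times> ('a list \<Rightarrow> 'b)" and n :: nat
        assume "?P x \<and> (n = 0 \<longrightarrow> x = (v0, g0))"
        then show "\<exists>y. (?P y \<and> (Suc n = 0 \<longrightarrow> y = (v0, g0))) \<and> ?Q x y"
          using step[of x] by simp
      qed
      then show ?thesis by blast
    qed
    then obtain x where "x 0 = (v0, g0)" "\<forall>n. ?P (x n) \<and> ?Q (x n) (x (Suc n))" by blast
    then show ?thesis by (intro exI[of _ x]) simp
  qed
  then obtain x where x0: "fst (x 0) = v0" "snd (x 0) = g0"
    and xs: "\<And>n. fst (x (Suc n)) \<in> succ (fst (x n)) (snd (x n) [fst (x n)])"
            "\<And>n. fst (x (Suc n)) \<notin> F"
            "\<And>n. snd (x (Suc n)) = (\<lambda>h. snd (x n) (fst (x n) # h))"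
    by blast
  define \<pi> where "\<pi> = (\<lambda>n. fst (x n))"
  \<comment> \<open>This glues the residuals back to \<open>g0\<close>: \<open>h\<close> is
    arbitrary so that the induction can absorb one more node, and a one-letter \<open>h\<close>
    gives the actual move.\<close>
  have g: "g0 (prefix n \<pi> @ h) = snd (x n) h" for n h
    by (induction n arbitrary: h) (simp_all add: x0 xs(3) \<pi>_def)
  have "\<pi> \<in> plays succ v0 g0"
    using xs(1) x0(1) g[of _ "[_]"] by (simp add: plays_def \<pi>_def)
  then have "\<exists>\<^sub>\<infinity>n. \<pi> n \<in> F" using g0 by (simp add: buchi_winning_def)
  \<comment> \<open>Index 0 is skipped, since \<open>v0\<close> itself may lie in
    \<open>F\<close>.\<close>
  then obtain n where "n > 0" "\<pi> n \<in> F" unfolding INFM_nat by blast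
  then show False using xs(2)[of "n - 1"] by (simp add: \<pi>_def)
qed

text \<open>The rank of a winning node is the first attractor stage containing it. An action under
  which every successor outside \<open>F\<close> has smaller rank can be chosen from the node alone,
  and the rank cannot fall forever.\<close>

lemma buchi_memoryless:
  assumes fin: "finite V" and cl: "\<And>v a. v \<in> V \<Longrightarrow> a \<in> A \<Longrightarrow> succ v a \<subseteq> V"
    and W: "W = {v \<in> V. \<exists>g. buchi_winning V A succ F v g}"
  obtains m where "\<And>v. v \<in> W \<Longrightarrow> m v \<in> A" "\<And>v. v \<in> W \<Longrightarrow> succ v (m v) \<subseteq> W"
    "\<And>\<pi>. range \<pi> \<subseteq> W \<Longrightarrow> (\<And>i. \<pi> (Suc i) \<in> succ (\<pi> i) (m (\<pi> i))) \<Longrightarrow> \<exists>\<^sub>\<infinity>i. \<pi> i \<in> F"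
proof -
  let ?R = "attractor W A succ F"
  define rk where "rk v = (LEAST n. v \<in> ?R n)" for v
  have "\<exists>a\<in>A. succ v a \<subseteq> W \<and> (\<forall>u\<in>succ v a - F. rk u < rk v)" if v: "v \<in> W" for v
  proof -
    from v winning_region_subset_attractor[OF fin cl W] have "\<exists>n. v \<in> ?R n" by blast
    then have r: "v \<in> ?R (rk v)" unfolding rk_def by (rule LeastI_ex)
    \<comment> \<open>Stage 0 is empty, so the rank is a successor.\<close>
    then obtain n where n: "rk v = Suc n" by (cases "rk v") auto
    with r obtain a where a: "a \<in> A" "succ v a \<subseteq> W" "succ v a \<subseteq> F \<union> ?R n" by auto
    have "rk u \<le> n" if "u \<in> succ v a - F" for u
      unfolding rk_def using that a(3) by (intro Least_le) blast
    with a n show ?thesis by force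
  qed
  then obtain m where m: "\<And>v. v \<in> W \<Longrightarrow> m v \<in> A" "\<And>v. v \<in> W \<Longrightarrow> succ v (m v) \<subseteq> W"
    "\<And>v u. v \<in> W \<Longrightarrow> u \<in> succ v (m v) - F \<Longrightarrow> rk u < rk v"
    by metis
  moreover have "\<exists>\<^sub>\<infinity>i. \<pi> i \<in> F"
    if p: "range \<pi> \<subseteq> W" "\<And>i. \<pi> (Suc i) \<in> succ (\<pi> i) (m (\<pi> i))" for \<pi>
    unfolding INFM_nat_le
  proof
    \<comment> \<open>Only the next visit is claimed: the rank decreases until \<open>F\<close> is
      entered and may jump up afterwards.\<close>
    have "\<exists>j>i. \<pi> j \<in> F" for i
    proof (induction "rk (\<pi> i)" arbitrary: i rule: less_induct)
      case less
      show ?case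
      proof (cases "\<pi> (Suc i) \<in> F")
        case False
        then have "rk (\<pi> (Suc i)) < rk (\<pi> i)" using m(3) p by blast
        from less[OF this] show ?thesis using Suc_lessD by blast
      qed blast
    qed
    then show "\<exists>j\<ge>i. \<pi> j \<in> F" for i using less_imp_le by blast
  qed
  ultimately show ?thesis using that by blast
qed

section \<open>Runs of total automata\<close>

text \<open>Totality makes \<open>\<rho>\<close> the only run on \<open>w\<close>. As there are
  finitely many accepting states, infinitely many visits to the set amount to one state visited
  infinitely often.\<close>

lemma total_buchi_accepts_iff:
  assumes "buchi \<A>" "total_buchi \<A>" and w: "range w \<subseteq> balphabet \<A>"
    and \<rho>: "\<rho> 0 \<in> binit \<A>" "\<And>i. (\<rho> i, w i, \<rho> (Suc i)) \<in> btrans \<A>"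
  shows "baccepts \<A> w \<longleftrightarrow> (\<exists>\<^sub>\<infinity>i. \<rho> i \<in> baccept \<A>)"
proof -
  have b: "btrans \<A> \<subseteq> bstates \<A> \<times> balphabet \<A> \<times> bstates \<A>" "finite (baccept \<A>)"
    using assms(1) by (auto simp: buchi_def intro: finite_subset)
  have unique: "\<rho>' = \<rho>" if "\<rho>' 0 \<in> binit \<A>" "\<And>i. (\<rho>' i, w i, \<rho>' (Suc i)) \<in> btrans \<A>" for \<rho>'
  proof
    show "\<rho>' i = \<rho> i" for i
    proof (induction i)
      case 0
      then show ?case
        using assms(2) that(1) \<rho>(1) by (auto simp: total_buchi_def is_singleton_def)
    next
      case (Suc i)
      have "is_singleton {x'. (\<rho> i, w i, x') \<in> btrans \<A>}"
        using assms(2) \<rho>(2)[of i] b(1) by (auto simp: total_buchi_def)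
      then show ?case using that(2)[of i] \<rho>(2)[of i] Suc
        by (auto simp: is_singleton_def set_eq_iff)
    qed
  qed
  have "range \<rho> \<subseteq> bstates \<A>" using \<rho>(2) b(1) by blast
  then have "baccepts \<A> w \<longleftrightarrow> (\<exists>x\<in>baccept \<A>. x \<in> limit \<rho>)"
    unfolding baccepts_def using \<rho> unique by metis
  also have "\<dots> \<longleftrightarrow> (\<exists>\<^sub>\<infinity>i. \<exists>x\<in>baccept \<A>. \<rho> i = x)"
    using INFM_finite_Bex_distrib[OF b(2), of "\<lambda>x i. \<rho> i = x"] by (simp add: limit_def)
  finally show ?thesis by simp
qed

section \<open>Plans from strategies\<close>

lemma agent_of_simps [simp]:
  "world_states (agent_of T q) = states T" "actions (agent_of T q) = controls T"
  "init (agent_of T q) = q"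
  by (simp_all add: agent_of_def)

lemma succs_agent_of:
  "q' \<in> succs (agent_of T q0) q a \<longleftrightarrow>
     q' \<in> states T \<and> (\<exists>b\<in>disturbances T. (q, a, b, q') \<in> trans T)"
  by (simp add: agent_of_def)

text \<open>A plan has finite memory, whereas \<open>f\<close> may use the whole history. The
  automaton state is memory enough: in the product the formula becomes a Buechi condition, for which
  memoryless strategies suffice.\<close>

lemma ex_reactive_plan:
  fixes T :: "('q, 'a, 'b, 'o) ats" and \<phi> :: "'p ltl"
  assumes "ats T" and fT: "finite_ats T" and nb: "non_blocking T" and dist: "disturbances T \<noteq> {}"
    and \<nu>: "\<nu> \<in> states T \<rightarrow> Pow P" and tot: "total_formula P \<phi>"
    and q: "q \<in> states T" and f: "control_strategy T f"
    and sat: "\<And>\<sigma>. \<sigma> \<in> Out T q f \<Longrightarrow> satisfies \<nu> \<sigma> \<phi>"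
  shows "\<exists>RP. reactive_plan (agent_of T q) RP \<and> plan_satisfies \<nu> RP \<phi>"
proof -

  \<comment> \<open>The automaton as a transition function\<close>
  obtain \<A> :: "(nat, 'p set) buchi" where A: "buchi \<A>" "total_buchi \<A>" "recognizes \<A> P \<phi>"
    using tot unfolding total_formula_def by blast
  have bt: "btrans \<A> \<subseteq> bstates \<A> \<times> balphabet \<A> \<times> bstates \<A>" "binit \<A> \<subseteq> bstates \<A>"
    using A(1) by (auto simp: buchi_def)
  have al: "balphabet \<A> = Pow P" using A(3) by (simp add: recognizes_def)
  obtain s0 where s0: "s0 \<in> binit \<A>"
    using A(2) by (auto simp: total_buchi_def is_singleton_def)
  have "\<exists>\<delta>. \<forall>s\<in>bstates \<A>. \<forall>l\<in>Pow P. (s, l, \<delta> s l) \<in> btrans \<A>"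
  \<comment> \<open>\<open>exI\<close> leaves the witness schematic; the last line fixes it to a
    chosen successor.\<close>
  proof (intro exI ballI)
    fix s l assume "s \<in> bstates \<A>" "l \<in> Pow P"
    then have "is_singleton {x'. (s, l, x') \<in> btrans \<A>}"
      using A(2) al unfolding total_buchi_def by simp
    then have "\<exists>x'. (s, l, x') \<in> btrans \<A>" by (auto simp: is_singleton_def)
    then show "(s, l, SOME x'. (s, l, x') \<in> btrans \<A>) \<in> btrans \<A>" by (rule someI_ex)
  qed
  then obtain \<delta> where \<delta>: "\<And>s l. s \<in> bstates \<A> \<Longrightarrow> l \<in> Pow P \<Longrightarrow> (s, l, \<delta> s l) \<in> btrans \<A>"
    by blast

  \<comment> \<open>The product game\<close>
  define su where "su = succs (agent_of T q)"
  have su: "q' \<in> su p a \<longleftrightarrow> q' \<in> states T \<and> (\<exists>b\<in>disturbances T. (p, a, b, q') \<in> trans T)" for p a q'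
    by (simp add: su_def succs_agent_of)
  define V where "V = states T \<times> bstates \<A>"
  \<comment> \<open>The automaton reads the label of the world state that is left, not of the one
    entered: in a run, letter \<open>w i\<close> leads from position \<open>i\<close> to
    \<open>Suc i\<close>.\<close>
  define sc where "sc v a = su (fst v) a \<times> {\<delta> (snd v) (\<nu> (fst v))}" for v a
  define F where "F = (UNIV :: 'q set) \<times> baccept \<A>"
  define W where "W = {v \<in> V. \<exists>g. buchi_winning V (controls T) sc F v g}"
  have fV: "finite V" using fT A(1) by (simp add: V_def finite_ats_def buchi_def)
  have \<delta>V: "(snd v, \<nu> (fst v), \<delta> (snd v) (\<nu> (fst v))) \<in> btrans \<A>" if "v \<in> V" for v
    using that \<delta>[of "snd v" "\<nu> (fst v)"] \<nu> by (auto simp: V_def Pi_def)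
  have cl: "sc v a \<subseteq> V" if "v \<in> V" for v a
    using \<delta>V[OF that] bt(1) by (auto simp: sc_def V_def su)
  \<comment> \<open>The automaton component of a play starting in \<open>s0\<close> is the run on
    the labels of its world states.\<close>
  have accept: "satisfies \<nu> (fst \<circ> \<pi>) \<phi> \<longleftrightarrow> (\<exists>\<^sub>\<infinity>i. \<pi> i \<in> F)"
    if "snd (\<pi> 0) = s0" "range \<pi> \<subseteq> V" "\<And>i. \<exists>a. \<pi> (Suc i) \<in> sc (\<pi> i) a" for \<pi>
  proof -
    have w: "range (\<nu> \<circ> (fst \<circ> \<pi>)) \<subseteq> Pow P"
      using that(2) \<nu> by (fastforce simp: V_def)
    have "((snd \<circ> \<pi>) i, (\<nu> \<circ> (fst \<circ> \<pi>)) i, (snd \<circ> \<pi>) (Suc i)) \<in> btrans \<A>" for i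
    proof -
      have "snd (\<pi> (Suc i)) = \<delta> (snd (\<pi> i)) (\<nu> (fst (\<pi> i)))"
        using that(3)[of i] by (auto simp: sc_def)
      moreover have "\<pi> i \<in> V" using that(2) by blast
      ultimately show ?thesis using \<delta>V[of "\<pi> i"] by simp
    qed
    then have "baccepts \<A> (\<nu> \<circ> (fst \<circ> \<pi>)) \<longleftrightarrow> (\<exists>\<^sub>\<infinity>i. (snd \<circ> \<pi>) i \<in> baccept \<A>)"
      using total_buchi_accepts_iff[OF A(1,2)] w al s0 that(1) by simp
    moreover have "\<pi> i \<in> F \<longleftrightarrow> (snd \<circ> \<pi>) i \<in> baccept \<A>" for i
      by (cases "\<pi> i") (simp add: F_def)
    ultimately show ?thesis
      using A(3) w by (simp add: satisfies_def recognizes_def)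
  qed

  \<comment> \<open>The initial node is winning\<close>
  have v0: "(q, s0) \<in> W"
  proof -
    have qV: "(q, s0) \<in> V" using q s0 bt(2) by (auto simp: V_def)
    \<comment> \<open>In the product, \<open>f\<close> is played by ignoring the automaton
      components of the history.\<close>
    have "buchi_winning V (controls T) sc F (q, s0) (\<lambda>h. f (map fst h))"
      unfolding buchi_winning_def
    proof (intro conjI ballI)
      show "\<forall>h. h \<noteq> [] \<and> set h \<subseteq> V \<longrightarrow> f (map fst h) \<in> controls T"
      proof (intro allI impI)
        fix h assume "h \<noteq> [] \<and> set h \<subseteq> V"
        then have "map fst h \<noteq> []" "set (map fst h) \<subseteq> states T" by (auto simp: V_def)
        then show "f (map fst h) \<in> controls T" using f by (simp add: control_strategy_def)
      qed
      fix \<pi> assume \<pi>: "\<pi> \<in> plays sc (q, s0) (\<lambda>h. f (map fst h))"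
      have st: "\<pi> (Suc i) \<in> sc (\<pi> i) (f (prefix (Suc i) (fst \<circ> \<pi>)))" for i
        using \<pi> by (simp add: plays_def subsequence_def del: upt_Suc)
      have "\<pi> i \<in> V" for i
      proof (induction i)
        case 0
        then show ?case using \<pi> qV by (simp add: plays_def)
      next
        case (Suc i)
        then show ?case using st[of i] cl by blast
      qed
      then have r: "range \<pi> \<subseteq> V" by blast
      have "fst \<circ> \<pi> \<in> Out T q f"
        unfolding Out_def
      proof (intro CollectI conjI allI)
        show "range (fst \<circ> \<pi>) \<subseteq> states T" using r by (auto simp: V_def)
        show "(fst \<circ> \<pi>) 0 = q" using \<pi> by (simp add: plays_def)
        fix i
        have "fst (\<pi> (Suc i)) \<in> su (fst (\<pi> i)) (f (prefix (Suc i) (fst \<circ> \<pi>)))"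
          using st[of i] unfolding sc_def by auto
        then show "\<exists>b\<in>disturbances T.
            ((fst \<circ> \<pi>) i, f (prefix (Suc i) (fst \<circ> \<pi>)), b, (fst \<circ> \<pi>) (Suc i)) \<in> trans T"
          by (simp add: su)
      qed
      then have "satisfies \<nu> (fst \<circ> \<pi>) \<phi>" by (rule sat)
      moreover have "snd (\<pi> 0) = s0" using \<pi> by (simp add: plays_def)
      ultimately show "\<exists>\<^sub>\<infinity>i. \<pi> i \<in> F" using accept r st by blast
    qed
    with qV show ?thesis unfolding W_def by blast
  qed

  \<comment> \<open>The plan built from the winning nodes\<close>
  have WV: "W \<subseteq> V" by (auto simp: W_def)
  obtain m where m: "\<And>v. v \<in> W \<Longrightarrow> m v \<in> controls T" "\<And>v. v \<in> W \<Longrightarrow> sc v (m v) \<subseteq> W"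
    "\<And>\<pi>. range \<pi> \<subseteq> W \<Longrightarrow> (\<And>i. \<pi> (Suc i) \<in> sc (\<pi> i) (m (\<pi> i))) \<Longrightarrow> \<exists>\<^sub>\<infinity>i. \<pi> i \<in> F"
    using buchi_memoryless[OF fV cl W_def] by blast
  obtain xs where xs: "set xs = W" using finite_subset[OF WV fV] finite_list by blast
  \<comment> \<open>Plan states count from 1, whence \<open>i - 1\<close>. The initial node is put
    in front to become plan state 1; it occurs in \<open>xs\<close> as well, and such a repetition
    is harmless.\<close>
  define h where "h i = ((q, s0) # xs) ! (i - 1)" for i
  define RP where "RP = \<lparr>nplan = Suc (length xs), lab = fst \<circ> h, act = m \<circ> h,
      nexts = (\<lambda>i. {j \<in> {1..Suc (length xs)}. h j \<in> sc (h i) (m (h i))})\<rparr>"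
  have ps: "plan_states RP = {1..Suc (length xs)}" by (simp add: plan_states_def RP_def)
  have hW: "h i \<in> W" if "i \<in> plan_states RP" for i
  proof -
    have "i - 1 < length ((q, s0) # xs)" using that ps by auto
    then have "h i \<in> set ((q, s0) # xs)" unfolding h_def by (rule nth_mem)
    then show ?thesis using xs v0 by auto
  qed
  have hsurj: "\<exists>i\<in>plan_states RP. h i = v" if v: "v \<in> W" for v
  proof -
    obtain n where "n < length xs" "xs ! n = v" using v xs by (auto simp: in_set_conv_nth)
    \<comment> \<open>Position \<open>n\<close> of \<open>xs\<close> is position
      \<open>n + 1\<close> behind the initial node, hence plan state \<open>n + 2\<close>.\<close>
    then show ?thesis by (intro bexI[of _ "n + 2"]) (auto simp: h_def ps)
  qed
  have nx: "j \<in> nexts RP i \<longleftrightarrow> j \<in> plan_states RP \<and> h j \<in> sc (h i) (m (h i))" for i j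
    unfolding ps by (simp add: RP_def)
  have la: "lab RP i = fst (h i)" "act RP i = m (h i)" for i by (simp_all add: RP_def)
  \<comment> \<open>Paired with the automaton successor, \<open>q'\<close> is a product node that a
    move of \<open>m\<close> may lead to; closure of \<open>W\<close> under these moves gives it a
    plan state.\<close>
  have ex_next: "\<exists>j\<in>nexts RP i. lab RP j = q'"
    if i: "i \<in> plan_states RP" and q': "q' \<in> su (lab RP i) (act RP i)" for i q'
  proof -
    have "(q', \<delta> (snd (h i)) (\<nu> (fst (h i)))) \<in> sc (h i) (m (h i))"
      using q' by (simp add: sc_def la)
    then obtain j where "j \<in> plan_states RP" "h j = (q', \<delta> (snd (h i)) (\<nu> (fst (h i))))"
      using hsurj m(2)[OF hW[OF i]] by blast
    then show ?thesis using q' by (intro bexI[of _ j]) (auto simp: nx la sc_def)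
  qed
  have h1: "h 1 = (q, s0)" by (simp add: h_def)
  have rp: "reactive_plan (agent_of T q) RP"
    unfolding reactive_plan_def su_def[symmetric]
  proof (intro conjI ballI)
    show "1 \<in> plan_states RP" by (simp add: ps)
    show "lab RP 1 = init (agent_of T q)" by (simp add: la h1[simplified])
    fix i assume i: "i \<in> plan_states RP"
    show "lab RP i \<in> world_states (agent_of T q)" "act RP i \<in> actions (agent_of T q)"
      using hW[OF i] WV m(1) by (auto simp: la V_def)
    show "nexts RP i \<subseteq> plan_states RP" by (auto simp: nx)
    show "lab RP j \<in> su (lab RP i) (act RP i)" if "j \<in> nexts RP i" for j
      using that by (auto simp: nx la sc_def)
    show "\<exists>j\<in>nexts RP i. lab RP j = q'" if "q' \<in> su (lab RP i) (act RP i)" for q'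
      using ex_next[OF i that] .
  qed

  \<comment> \<open>Trajectories of the plan\<close>
  have "satisfies \<nu> \<sigma> \<phi>" if "\<sigma> \<in> trajectories RP" for \<sigma>
  proof -
    from that obtain r where r: "range r \<subseteq> plan_states RP" "r 0 = 1"
      "\<And>j. r (Suc j) \<in> nexts RP (r j)" "\<And>j. lab RP (r j) = \<sigma> j"
      unfolding trajectories_def by blast
    \<comment> \<open>Mapping plan states to nodes turns a run of the plan into a play inside
      \<open>W\<close> that follows \<open>m\<close>.\<close>
    have st: "(h \<circ> r) (Suc i) \<in> sc ((h \<circ> r) i) (m ((h \<circ> r) i))" for i
      using r(3)[of i] by (simp add: nx)
    have rW: "range (h \<circ> r) \<subseteq> W" using r(1) hW by auto
    have "\<exists>\<^sub>\<infinity>i. (h \<circ> r) i \<in> F" using m(3)[OF rW st] .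
    moreover have "fst \<circ> (h \<circ> r) = \<sigma>" using r(4) by (auto simp: la)
    moreover have "snd ((h \<circ> r) 0) = s0" by (simp add: r(2) h1[simplified])
    ultimately show ?thesis using accept[of "h \<circ> r"] rW WV st by blast
  qed
  \<comment> \<open>\<open>plan_satisfies\<close> demands a trajectory. A disturbance exists and
    \<open>T\<close> is non-blocking, so every plan state has a successor.\<close>
  moreover have "trajectories RP \<noteq> {}"
  proof -
    have "\<exists>r. \<forall>n. (r n \<in> plan_states RP \<and> (n = 0 \<longrightarrow> r n = 1)) \<and> r (Suc n) \<in> nexts RP (r n)"
    proof (rule dependent_nat_choice)
      show "\<exists>x. x \<in> plan_states RP \<and> ((0::nat) = 0 \<longrightarrow> x = 1)" by (simp add: ps)
      fix x and n :: nat assume x: "x \<in> plan_states RP \<and> (n = 0 \<longrightarrow> x = (1::nat))"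
      obtain b where b: "b \<in> disturbances T" using dist by blast
      have "lab RP x \<in> states T" "act RP x \<in> controls T"
        using x hW[of x] WV m(1) by (auto simp: la V_def)
      then obtain q' where "(lab RP x, act RP x, b, q') \<in> trans T"
        using nb b unfolding non_blocking_def by blast
      moreover from this have "q' \<in> states T" using \<open>ats T\<close> by (auto simp: ats_def)
      ultimately have "q' \<in> su (lab RP x) (act RP x)" using b by (auto simp: su)
      then obtain j where "j \<in> nexts RP x" using ex_next x by blast
      then show "\<exists>y. (y \<in> plan_states RP \<and> (Suc n = 0 \<longrightarrow> y = 1)) \<and> y \<in> nexts RP x"
        using nx by auto
    qed
    then obtain r where "\<And>n. r n \<in> plan_states RP" "r 0 = 1" "\<And>n. r (Suc n) \<in> nexts RP (r n)"
      by blast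
    then have "(lab RP \<circ> r) \<in> trajectories RP" unfolding trajectories_def by fastforce
    then show ?thesis by blast
  qed
  ultimately have "plan_satisfies \<nu> RP \<phi>" by (simp add: plan_satisfies_def)
  with rp show ?thesis by blast
qed

section \<open>Strategies from plans\<close>

text \<open>Under this condition a history of world states is followed by at most one run of the
  plan, so the \<open>THE\<close> in \<open>plan_strategy\<close> is meaningful.\<close>

definition deterministic_plan :: "('q, 'a) plan \<Rightarrow> bool" where
  "deterministic_plan RP \<longleftrightarrow> (\<forall>i\<in>plan_states RP. inj_on (lab RP) (nexts RP i))"

text \<open>Each family of equally labelled successors shrinks to one element: no label is lost,
  labels become injective, and no run is added.\<close>

lemma simplification_of_plan:
  assumes rp: "reactive_plan ag RP" and s: "simplification_of RP RP'"
  shows "reactive_plan ag RP'" "deterministic_plan RP'" "trajectories RP' \<subseteq> trajectories RP"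
proof -
  have eq: "plan_states RP' = plan_states RP" "lab RP' = lab RP" "act RP' = act RP"
    using s by (simp_all add: simplification_of_def plan_states_def)
  have sub: "nexts RP' i \<subseteq> nexts RP i" if "i \<in> plan_states RP" for i
    using s that unfolding simplification_of_def by blast
  have one: "same_lab RP' i q = same_lab RP i q \<and> card (same_lab RP i q) \<le> 1 \<or>
      (\<exists>j. same_lab RP' i q = {j})" if "i \<in> plan_states RP" for i q
    using s that unfolding simplification_of_def by (metis not_le)
  have keep: "\<exists>j\<in>nexts RP' i. lab RP' j = q"
    if i: "i \<in> plan_states RP" and q: "\<exists>j\<in>nexts RP i. lab RP j = q" for i q
  proof -
    have "same_lab RP i q \<noteq> {}" using q by (auto simp: same_lab_def)
    then have "same_lab RP' i q \<noteq> {}" using one[OF i, of q] by auto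
    then show ?thesis by (auto simp: same_lab_def)
  qed
  show "reactive_plan ag RP'"
    unfolding reactive_plan_def eq(1)
  proof (intro conjI ballI)
    show "1 \<in> plan_states RP" "lab RP' 1 = init ag" using rp eq by (simp_all add: reactive_plan_def)
    fix i assume i: "i \<in> plan_states RP"
    show "lab RP' i \<in> world_states ag" "act RP' i \<in> actions ag"
      using rp i eq unfolding reactive_plan_def by auto
    show "nexts RP' i \<subseteq> plan_states RP"
      using rp i sub[OF i] unfolding reactive_plan_def by blast
    show "lab RP' j \<in> succs ag (lab RP' i) (act RP' i)" if "j \<in> nexts RP' i" for j
      using rp i eq sub[OF i] that unfolding reactive_plan_def by auto
    show "\<exists>j\<in>nexts RP' i. lab RP' j = q'" if "q' \<in> succs ag (lab RP' i) (act RP' i)" for q'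
      using rp i eq keep[OF i, of q'] that unfolding reactive_plan_def by auto
  qed
  show "deterministic_plan RP'"
    unfolding deterministic_plan_def eq(1)
  proof (intro ballI inj_onI)
    fix i x y
    assume i: "i \<in> plan_states RP" and x: "x \<in> nexts RP' i" and y: "y \<in> nexts RP' i"
      and xy: "lab RP' x = lab RP' y"
    \<comment> \<open>\<open>card\<close> is 0 on infinite sets, so \<open>card \<le> 1\<close>
      bounds a family only once it is known to be finite.\<close>
    have "finite (nexts RP i)"
      using rp i unfolding reactive_plan_def plan_states_def by (meson finite_atLeastAtMost finite_subset)
    then have "finite (same_lab RP i (lab RP' y))" by (simp add: same_lab_def)
    moreover have "x \<in> same_lab RP' i (lab RP' y)" "y \<in> same_lab RP' i (lab RP' y)"
      using x y xy by (simp_all add: same_lab_def)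
    ultimately show "x = y"
      using one[OF i, of "lab RP' y"] by (metis One_nat_def card_le_Suc0_iff_eq singletonD)
  qed
  show "trajectories RP' \<subseteq> trajectories RP"
  proof
    fix \<sigma> assume "\<sigma> \<in> trajectories RP'"
    then obtain r where r: "range r \<subseteq> plan_states RP" "r 0 = 1"
      "\<And>j. r (Suc j) \<in> nexts RP' (r j)" "\<And>j. lab RP (r j) = \<sigma> j"
      unfolding trajectories_def eq by blast
    moreover have "r (Suc j) \<in> nexts RP (r j)" for j using r(1,3) sub by blast
    ultimately show "\<sigma> \<in> trajectories RP" unfolding trajectories_def by blast
  qed
qed

text \<open>Both lists start in plan state 1, and each further plan state is determined by its
  predecessor and the label it must carry.\<close>

lemma follows_unique:
  assumes d: "deterministic_plan RP" and t: "follows RP s t" and u: "follows RP s u"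
  shows "t = u"
proof (rule nth_equalityI)
  show "length t = length u" using t u by (simp add: follows_def)
  show "t ! i = u ! i" if "i < length t" for i
    using that
  proof (induction i)
    case 0
    then show ?case using t u by (simp add: follows_def)
  next
    case (Suc i)
    have l: "length t = length s" using t by (simp add: follows_def)
    have "t ! i \<in> plan_states RP" using t Suc.prems unfolding follows_def by (meson Suc_lessD nth_mem subsetD)
    moreover have "t ! Suc i \<in> nexts RP (t ! i)" "u ! Suc i \<in> nexts RP (t ! i)"
      using t u Suc l by (auto simp: follows_def)
    moreover have "lab RP (t ! Suc i) = lab RP (u ! Suc i)"
      using t u Suc.prems l by (metis follows_def)
    ultimately show ?case using d unfolding deterministic_plan_def inj_on_def by blast
  qed
qed

lemma plan_strategy_follows:
  assumes "deterministic_plan RP" "follows RP s t"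
  shows "plan_strategy RP s = act RP (last t)"
proof -
  have "(THE u. follows RP s u) = t"
    using assms follows_unique by (intro the_equality) blast+
  then show ?thesis using assms(2) by (auto simp: plan_strategy_def)
qed

lemma control_strategy_plan_strategy:
  assumes rp: "reactive_plan (agent_of T q) RP" and d: "deterministic_plan RP"
  shows "control_strategy T (plan_strategy RP)"
  unfolding control_strategy_def
proof (intro allI impI)
  fix s
  have act: "act RP i \<in> controls T" if "i \<in> plan_states RP" for i
    using rp that by (auto simp: reactive_plan_def)
  show "plan_strategy RP s \<in> controls T"
  proof (cases "\<exists>t. follows RP s t")
    case True
    then obtain t where t: "follows RP s t" ..
    then have "last t \<in> plan_states RP" unfolding follows_def using last_in_set by blast
    then show ?thesis using plan_strategy_follows[OF d t] act by simp
  next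
    case False
    \<comment> \<open>Histories that no run of the plan follows receive the action of plan state 1,
      which is a control too.\<close>
    then show ?thesis using act rp by (simp add: plan_strategy_def reactive_plan_def)
  qed
qed

text \<open>The plan run is rebuilt along the outcome: the strategy plays the action of the current
  plan state, so the next world state is one of its successors and the plan has a next state with
  that label.\<close>

lemma Out_plan_strategy_subset_trajectories:
  assumes rp: "reactive_plan (agent_of T q) RP" and d: "deterministic_plan RP"
  shows "Out T q (plan_strategy RP) \<subseteq> trajectories RP"
proof
  fix \<sigma> assume "\<sigma> \<in> Out T q (plan_strategy RP)"
  then have \<sigma>: "range \<sigma> \<subseteq> states T" "\<sigma> 0 = q"
    "\<And>i. \<exists>b\<in>disturbances T. (\<sigma> i, plan_strategy RP (prefix (Suc i) \<sigma>), b, \<sigma> (Suc i)) \<in> trans T"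
    by (auto simp only: Out_def)
  \<comment> \<open>The choice is meaningful only if a candidate exists; the induction below
    provides one at each step.\<close>
  define r where "r = rec_nat 1 (\<lambda>n j. SOME k. k \<in> nexts RP j \<and> lab RP k = \<sigma> (Suc n))"
  have r0: "r 0 = 1" and rS: "\<And>n. r (Suc n) = (SOME k. k \<in> nexts RP (r n) \<and> lab RP k = \<sigma> (Suc n))"
    by (simp_all add: r_def)
  have one: "1 \<in> plan_states RP" "lab RP 1 = q" using rp by (auto simp: reactive_plan_def)
  \<comment> \<open>The whole initial segment is carried along, because the next action is computed
    from the full run so far through \<open>follows\<close>.\<close>
  have r: "(\<forall>k\<le>n. r k \<in> plan_states RP \<and> lab RP (r k) = \<sigma> k) \<and> (\<forall>k<n. r (Suc k) \<in> nexts RP (r k))" for n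
  proof (induction n)
    case 0
    then show ?case using one r0 \<sigma>(2) by simp
  next
    case (Suc n)
    have "follows RP (prefix (Suc n) \<sigma>) (prefix (Suc n) r)"
      using Suc r0 by (auto simp: follows_def simp del: subseq_to_Suc)
    then have "plan_strategy RP (prefix (Suc n) \<sigma>) = act RP (r n)"
      using plan_strategy_follows[OF d] by fastforce
    then have "\<sigma> (Suc n) \<in> succs (agent_of T q) (lab RP (r n)) (act RP (r n))"
      using \<sigma>(1) \<sigma>(3)[of n] Suc by (auto simp: succs_agent_of)
    then have "\<exists>k. k \<in> nexts RP (r n) \<and> lab RP k = \<sigma> (Suc n)"
      using rp Suc unfolding reactive_plan_def by blast
    then have "r (Suc n) \<in> nexts RP (r n) \<and> lab RP (r (Suc n)) = \<sigma> (Suc n)"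
      unfolding rS by (rule someI_ex)
    moreover have "nexts RP (r n) \<subseteq> plan_states RP"
      using rp Suc unfolding reactive_plan_def by blast
    ultimately show ?case using Suc by (auto simp: le_Suc_eq less_Suc_eq)
  qed
  then have "range r \<subseteq> plan_states RP" "\<And>j. lab RP (r j) = \<sigma> j" by blast+
  moreover have "r (Suc j) \<in> nexts RP (r j)" for j using r[of "Suc j"] by blast
  ultimately show "\<sigma> \<in> trajectories RP" unfolding trajectories_def using r0 by blast
qed

text \<open>The search stops at the first state where the planner succeeds, which may come before
  the one assumed to exist; hence the new witness.\<close>

lemma control_strategy_algorithm_finds:
  assumes "\<exists>q\<in>set qs. planner (agent_of T q) \<phi> \<nu> \<noteq> None"
  shows "\<exists>q\<in>set qs. \<exists>RP. planner (agent_of T q) \<phi> \<nu> = Some RP \<and>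
    control_strategy_algorithm planner simplify qs T \<phi> \<nu> = Some (q, plan_strategy (simplify RP))"
  using assms by (induction qs) (auto split: option.split)

theorem theorem5p13:
  fixes T :: "('q, 'a, 'b, 'o) ats"
    and P :: "'p set"
    and \<phi> :: "'p ltl"
    and \<nu> :: "'q \<Rightarrow> 'p set"
    and planner :: "('q, 'a, 'p) planner"
    and simplify :: "('q, 'a) plan \<Rightarrow> ('q, 'a) plan"
    and qs :: "'q list"
  assumes "ats T" and "finite_ats T" and "non_blocking T" and "disturbances T \<noteq> {}"
    and "finite P" and "ltl_over P \<phi>" and "\<nu> \<in> states T \<rightarrow> Pow P"
    and "\<forall>q\<^sub>0\<in>states T. planner_correct planner (agent_of T q\<^sub>0) \<phi> \<nu>"
    and "simplifier simplify"
    and "distinct qs" and "set qs = states T"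
    and "total_formula P \<phi>"
    and "\<exists>q\<in>states T. \<exists>f. control_strategy T f \<and> (\<forall>\<sigma>\<in>Out T q f. satisfies \<nu> \<sigma> \<phi>)"
  shows "\<exists>q' f'. control_strategy_algorithm planner simplify qs T \<phi> \<nu> = Some (q', f') \<and>
           q' \<in> states T \<and> control_strategy T f' \<and> (\<forall>\<sigma>\<in>Out T q' f'. satisfies \<nu> \<sigma> \<phi>)"
proof -
  obtain q f where "q \<in> states T" "control_strategy T f" "\<And>\<sigma>. \<sigma> \<in> Out T q f \<Longrightarrow> satisfies \<nu> \<sigma> \<phi>"
    using assms(13) by blast
  then have "\<exists>RP. reactive_plan (agent_of T q) RP \<and> plan_satisfies \<nu> RP \<phi>"
    using ex_reactive_plan[OF assms(1-4,7,12)] by blast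
  then have "planner (agent_of T q) \<phi> \<nu> \<noteq> None"
    using assms(8) \<open>q \<in> states T\<close> by (auto simp: planner_correct_def)
  then obtain q' RP where q': "q' \<in> states T" and RP: "planner (agent_of T q') \<phi> \<nu> = Some RP"
    and alg: "control_strategy_algorithm planner simplify qs T \<phi> \<nu>
      = Some (q', plan_strategy (simplify RP))"
    using control_strategy_algorithm_finds[of qs planner T \<phi> \<nu> simplify] assms(11) \<open>q \<in> states T\<close>
    by blast
  have rp: "reactive_plan (agent_of T q') RP" and sat: "plan_satisfies \<nu> RP \<phi>"
    using assms(8) q' RP by (auto simp: planner_correct_def)
  then have "simplification_of RP (simplify RP)" using assms(9) unfolding simplifier_def by blast
  note simp_RP = simplification_of_plan[OF rp this]
  have "Out T q' (plan_strategy (simplify RP)) \<subseteq> trajectories RP"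
    using Out_plan_strategy_subset_trajectories[OF simp_RP(1,2)] simp_RP(3) by blast
  then show ?thesis
    using alg q' control_strategy_plan_strategy[OF simp_RP(1,2)] sat
    unfolding plan_satisfies_def by blast
qed

end
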